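(* (Finite sample guarantee) Let $\beta\in(0,1)$ be a prescribed significance parameter. Suppose that the true distribution $\mathcal{P}$ is light-tailed, i.e. there exists a constant $b>1$ such that $\mathbb{E}_{\mathcal{P}}[\exp(\|\boldsymbol{w}\|^b)]<\infty$, and that $\underline{\theta}^N\ge\epsilon^N(\beta)$, where $\underline{\theta}^N=\min_{k\in[K]}\frac{|\Gamma^N_k|}{|\Gamma^N|}\theta_k$. Then $$\mathcal{P}^N\Big\{f(\widehat{\boldsymbol{x}}_N)+\mathbb{E}_{\mathcal{P}}[g(\widehat{\boldsymbol{x}}_N,\boldsymbol{w})]\le\widehat{J}_N\Big\}\ge1-\beta,$$ where the probability is over the data set $(\widehat{\boldsymbol{w}}_1,\dots,\widehat{\boldsymbol{w}}_N)\sim\mathcal{P}^N$, and in $\mathbb{E}_{\mathcal{P}}[g(\widehat{\boldsymbol{x}}_N,\boldsymbol{w})]$ the expectation is over $\boldsymbol{w}\sim\mathcal{P}$ with $\widehat{\boldsymbol{x}}_N$ held fixed.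
   Context: $[N]=\{1,\dots,N\}$; $\mathscr{X}\subseteq\mathbb{R}^n$ is the feasible region; $\varXi\subseteq\mathbb{R}^m$ is the support of the uncertainty $\boldsymbol{w}$, whose true distribution is $\mathcal{P}$; $f:\mathbb{R}^n\to\overline{\mathbb{R}}$ and $g:\mathbb{R}^n\times\mathbb{R}^m\to\overline{\mathbb{R}}$ are loss functions, $\overline{\mathbb{R}}=\mathbb{R}\cup\{\pm\infty\}$. $\mathcal{P}^N$ is the $N$-fold product of $\mathcal{P}$. $\|\cdot\|$ is a norm on $\mathbb{R}^m$. $\mathscr{P}(\varXi)$ is the set of Borel probability measures supported on $\varXi$; $d_W(\mathbb{Q},\mathbb{P})=\inf_{\pi\in\Pi(\mathbb{Q},\mathbb{P})}\int\|\boldsymbol{x}-\boldsymbol{y}\|\,d\pi(\boldsymbol{x},\boldsymbol{y})$, with $\Pi(\mathbb{Q},\mathbb{P})$ the measures on $\varXi\times\varXi$ with marginals $\mathbb{Q},\mathbb{P}$; $\mathscr{W}_\theta(\mathbb{P})=\{\mathbb{Q}\in\mathscr{P}(\varXi):d_W(\mathbb{Q},\mathbb{P})\le\theta\}$. $\Gamma^N$ is the collection of $N$ data $\widehat{\boldsymbol{w}}_l$, $l\in[N]$, drawn independently from $\mathcal{P}$ (counted with multiplicity, $|\Gamma^N|=N$), with empirical distribution $\widehat{\mathbb{P}}^N=\frac1N\sum_{l}\delta_{\widehat{\boldsymbol{w}}_l}$. The data are partitioned by a clustering rule into $K$ nonempty clusters $\Gamma^N_k$, $k\in[K]$ (in the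 paper, maximum-posterior labels of a Dirichlet process mixture model; $K$ and the partition may depend on the data). $\widehat{\mathbb{P}}^N_k=\frac1{|\Gamma^N_k|}\sum_{\widehat{\boldsymbol{w}}\in\Gamma^N_k}\delta_{\widehat{\boldsymbol{w}}}$, and $\theta_k>0$ is the Wasserstein radius of cluster $k$. The data-driven ambiguity set is $$\mathscr{B}(\Gamma^N)=\Big\{\sum_{k=1}^K\frac{|\Gamma^N_k|}{|\Gamma^N|}\mathbb{Q}_k:\ \mathbb{Q}_k\in\mathscr{W}_{\theta_k}(\widehat{\mathbb{P}}^N_k),\ k\in[K]\Big\}.$$ The optimal value and an optimal solution of the robust problem are $$\widehat{J}_N=\min_{\boldsymbol{x}\in\mathscr{X}}\Big\{f(\boldsymbol{x})+\sup_{\mathbb{Q}\in\mathscr{B}(\Gamma^N)}\mathbb{E}_{\mathbb{Q}}[g(\boldsymbol{x},\boldsymbol{w})]\Big\},\qquad \widehat{\boldsymbol{x}}_N\in\operatorname*{arg\,min}_{\boldsymbol{x}\in\mathscr{X}}\Big\{f(\boldsymbol{x})+\sup_{\mathbb{Q}\in\mathscr{B}(\Gamma^N)}\mathbb{E}_{\mathbb{Q}}[g(\boldsymbol{x},\boldsymbol{w})]\Big\},$$ a minimizer being understood to exist. The radius $\epsilon^N(\beta)$ is that of the known measure concentration inequality for light-tailed distributions (Mohajerin Esfahani and Kuhn): $b_1,b_2$ are positive constants depending on $\mathcal{P}$ such that, for all $N\ge1$ and $\beta\in(0,1)$, $\mathcal{P}^N\{d_W(\mathcal{P},\widehat{\mathbb{P}}^N)\ge\epsilon^N(\beta)\}\le\beta$,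 where $$\epsilon^N(\beta)=\begin{cases}\Big(\frac{\log(b_1\beta^{-1})}{b_2N}\Big)^{1/\max\{m,2\}},&N\ge\frac{\log(b_1\beta^{-1})}{b_2},\\[4pt]\Big(\frac{\log(b_1\beta^{-1})}{b_2N}\Big)^{1/b},&N<\frac{\log(b_1\beta^{-1})}{b_2},\end{cases}$$ with $b$ the light-tail exponent (the bases of the powers being nonnegative). *)

theory Defs
  imports "HOL-Probability.Probability"
begin

section \<open>Norms, mixtures, and the Wasserstein ball\<close>

text \<open>An arbitrary norm on the space, not necessarily the Euclidean one carried by the type class.\<close>

definition is_norm :: "('a::real_vector \<Rightarrow> real) \<Rightarrow> bool" where
  "is_norm nrm \<longleftrightarrow>
     (\<forall>x. 0 \<le> nrm x) \<and> (\<forall>x. nrm x = 0 \<longleftrightarrow> x = 0) \<and>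
     (\<forall>r x. nrm (r *\<^sub>R x) = \<bar>r\<bar> * nrm x) \<and> (\<forall>x y. nrm (x + y) \<le> nrm x + nrm y)"

definition prob_measures_on :: "'a::topological_space set \<Rightarrow> 'a measure set" where
  "prob_measures_on \<Xi> = {Q. sets Q = sets borel \<and> prob_space Q \<and> (AE w in Q. w \<in> \<Xi>)}"

definition mixture :: "nat set \<Rightarrow> (nat \<Rightarrow> real) \<Rightarrow> (nat \<Rightarrow> 'a::topological_space measure) \<Rightarrow> 'a measure" where
  "mixture I a Q = measure_of UNIV (sets borel) (\<lambda>A. \<Sum>i\<in>I. ennreal (a i) * emeasure (Q i) A)"

lemma space_mixture [simp]: "space (mixture I a Q) = UNIV"
  by (simp add: mixture_def space_measure_of_conv)

lemma sets_mixture [simp]: "sets (mixture I a Q) = sets borel"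
proof -
  have "sigma_sets UNIV (sets (borel :: 'a measure)) = sets borel"
    using sets.sigma_sets_eq[of "borel :: 'a measure"] by simp
  thus ?thesis by (simp add: mixture_def)
qed

lemma emeasure_mixture:
  assumes Q: "\<And>i. i \<in> I \<Longrightarrow> sets (Q i) = sets borel" and A: "A \<in> sets borel"
  shows "emeasure (mixture I a Q) A = (\<Sum>i\<in>I. ennreal (a i) * emeasure (Q i) A)"
proof (rule emeasure_measure_of[OF mixture_def])
  let ?\<mu> = "\<lambda>A. \<Sum>i\<in>I. ennreal (a i) * emeasure (Q i) A"
  show "positive (sets (mixture I a Q)) ?\<mu>" by (simp add: positive_def)
  show "countably_additive (sets (mixture I a Q)) ?\<mu>"
  proof (rule countably_additiveI)
    fix B :: "nat \<Rightarrow> 'a set"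
    assume B: "range B \<subseteq> sets (mixture I a Q)" "disjoint_family B"
    have "(\<Sum>n. ?\<mu> (B n)) = (\<Sum>i\<in>I. \<Sum>n. ennreal (a i) * emeasure (Q i) (B n))"
      by (rule suminf_sum) simp
    also have "\<dots> = (\<Sum>i\<in>I. ennreal (a i) * emeasure (Q i) (\<Union>n. B n))"
      using B Q by (intro sum.cong refl) (simp add: ennreal_suminf_cmult suminf_emeasure)
    finally show "(\<Sum>n. ?\<mu> (B n)) = ?\<mu> (\<Union>n. B n)" .
  qed
qed (use A in auto)

text \<open>The empirical distribution of the data with indices in \<open>I\<close>; data are indexed, so repeated
  values are counted with multiplicity.\<close>

definition empirical :: "nat set \<Rightarrow> (nat \<Rightarrow> 'a::topological_space) \<Rightarrow> 'a measure" where
  "empirical I w = mixture I (\<lambda>_. 1 / real (card I)) (\<lambda>l. return borel (w l))"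

definition couplings :: "'a::topological_space set \<Rightarrow> 'a measure \<Rightarrow> 'a measure \<Rightarrow> ('a \<times> 'a) measure set" where
  "couplings \<Xi> Q P =
     {\<pi>. sets \<pi> = sets (borel \<Otimes>\<^sub>M borel) \<and> (AE z in \<pi>. z \<in> \<Xi> \<times> \<Xi>) \<and>
         distr \<pi> borel fst = Q \<and> distr \<pi> borel snd = P}"

definition wasserstein ::
  "('a::{topological_space, minus} \<Rightarrow> real) \<Rightarrow> 'a set \<Rightarrow> 'a measure \<Rightarrow> 'a measure \<Rightarrow> ennreal" where
  "wasserstein nrm \<Xi> Q P = (INF \<pi>\<in>couplings \<Xi> Q P. \<integral>\<^sup>+z. ennreal (nrm (fst z - snd z)) \<partial>\<pi>)"

definition wasserstein_ball ::
  "('a::{topological_space, minus} \<Rightarrow> real) \<Rightarrow> 'a set \<Rightarrow> real \<Rightarrow> 'a measure \<Rightarrow> 'a measure set" where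
  "wasserstein_ball nrm \<Xi> \<theta> P = {Q \<in> prob_measures_on \<Xi>. wasserstein nrm \<Xi> Q P \<le> ennreal \<theta>}"

section \<open>Clusters and the ambiguity set\<close>

text \<open>A data set of size \<open>N\<close> is a function on \<open>{1..N}\<close>. A clustering rule assigns to each data set
  \<open>w\<close> a number \<open>K w\<close> of clusters and a labelling \<open>lab w\<close> of the data indices; surjectivity onto
  \<open>{1..K w}\<close> says that all clusters are nonempty.\<close>

definition clustering_rule ::
  "'a set \<Rightarrow> nat \<Rightarrow> ((nat \<Rightarrow> 'a) \<Rightarrow> nat) \<Rightarrow> ((nat \<Rightarrow> 'a) \<Rightarrow> nat \<Rightarrow> nat) \<Rightarrow> bool" where
  "clustering_rule \<Xi> N K lab \<longleftrightarrow> (\<forall>w \<in> {1..N} \<rightarrow>\<^sub>E \<Xi>. lab w ` {1..N} = {1..K w})"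

definition cluster :: "nat \<Rightarrow> (nat \<Rightarrow> nat) \<Rightarrow> nat \<Rightarrow> nat set" where
  "cluster N l k = {i \<in> {1..N}. l i = k}"

definition ambiguity_set ::
  "('a::{topological_space, minus} \<Rightarrow> real) \<Rightarrow> 'a set \<Rightarrow> nat \<Rightarrow> nat \<Rightarrow> (nat \<Rightarrow> nat) \<Rightarrow> (nat \<Rightarrow> real)
    \<Rightarrow> (nat \<Rightarrow> 'a) \<Rightarrow> 'a measure set" where
  "ambiguity_set nrm \<Xi> N K l \<theta> w =
     {mixture {1..K} (\<lambda>k. real (card (cluster N l k)) / real N) Q | Q.
        \<forall>k\<in>{1..K}. Q k \<in> wasserstein_ball nrm \<Xi> (\<theta> k) (empirical (cluster N l k) w)}"

definition theta_min :: "nat \<Rightarrow> nat \<Rightarrow> (nat \<Rightarrow> nat) \<Rightarrow> (nat \<Rightarrow> real) \<Rightarrow> real" where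
  "theta_min N K l \<theta> = Min ((\<lambda>k. real (card (cluster N l k)) / real N * \<theta> k) ` {1..K})"

section \<open>Expectations and the robust problem\<close>

text \<open>Expectation of an extended-real function as positive part minus negative part. If both parts
  are infinite the value is \<open>\<infinity> - \<infinity> = \<infinity>\<close> in \<^typ>\<open>ereal\<close>, the usual convention for minimization.\<close>

definition expect :: "'a measure \<Rightarrow> ('a \<Rightarrow> ereal) \<Rightarrow> ereal" where
  "expect Q h = enn2ereal (\<integral>\<^sup>+w. e2ennreal (h w) \<partial>Q) - enn2ereal (\<integral>\<^sup>+w. e2ennreal (- h w) \<partial>Q)"

definition robust_objective ::
  "('x \<Rightarrow> ereal) \<Rightarrow> ('x \<Rightarrow> 'a \<Rightarrow> ereal) \<Rightarrow> 'a measure set \<Rightarrow> 'x \<Rightarrow> ereal" where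
  "robust_objective f g B x = f x + (SUP Q\<in>B. expect Q (g x))"

definition robust_value ::
  "'x set \<Rightarrow> ('x \<Rightarrow> ereal) \<Rightarrow> ('x \<Rightarrow> 'a \<Rightarrow> ereal) \<Rightarrow> 'a measure set \<Rightarrow> ereal" where
  "robust_value X f g B = (INF x\<in>X. robust_objective f g B x)"

section \<open>Light tails and measure concentration\<close>

definition light_tailed :: "('a \<Rightarrow> real) \<Rightarrow> 'a measure \<Rightarrow> real \<Rightarrow> bool" where
  "light_tailed nrm P b \<longleftrightarrow> b > 1 \<and> (\<integral>\<^sup>+w. ennreal (exp (nrm w powr b)) \<partial>P) < \<infinity>"

definition conc_radius :: "nat \<Rightarrow> real \<Rightarrow> real \<Rightarrow> real \<Rightarrow> nat \<Rightarrow> real \<Rightarrow> real" where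
  "conc_radius m b b1 b2 N \<beta> =
     (if real N \<ge> ln (b1 / \<beta>) / b2
      then (ln (b1 / \<beta>) / (b2 * real N)) powr (1 / real (max m 2))
      else (ln (b1 / \<beta>) / (b2 * real N)) powr (1 / b))"

abbreviation sample_measure :: "nat \<Rightarrow> 'a measure \<Rightarrow> (nat \<Rightarrow> 'a) measure" where
  "sample_measure N P \<equiv> Pi\<^sub>M {1..N} (\<lambda>_. P)"

text \<open>Probabilities of events that are not assumed to lie in the \<sigma>-algebra are taken as outer
  probability in upper bounds and as inner probability in lower bounds. Both agree with
  \<^const>\<open>emeasure\<close> on measurable sets (\<open>outer_measure_of_eq\<close>, \<open>inner_measure_of_eq\<close>), whereas
  \<^const>\<open>emeasure\<close> itself is \<open>0\<close> on nonmeasurable ones.\<close>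

definition inner_measure_of :: "'a measure \<Rightarrow> 'a set \<Rightarrow> ennreal" where
  "inner_measure_of M A = (SUP B\<in>{B \<in> sets M. B \<subseteq> A}. emeasure M B)"

lemma inner_measure_of_eq [simp]: "A \<in> sets M \<Longrightarrow> inner_measure_of M A = emeasure M A"
  unfolding inner_measure_of_def by (rule SUP_eqI) (auto intro: emeasure_mono)

text \<open>The constants \<open>b1\<close>, \<open>b2\<close> of the measure concentration inequality for \<open>P\<close>. The condition
  \<open>ln (b1 / \<beta>) \<ge> 0\<close> keeps the bases of the powers in \<^const>\<open>conc_radius\<close> nonnegative.\<close>

definition concentration_constants ::
  "('a::{topological_space, minus} \<Rightarrow> real) \<Rightarrow> 'a set \<Rightarrow> 'a measure \<Rightarrow> nat \<Rightarrow> real \<Rightarrow> real \<Rightarrow> real \<Rightarrow> bool" where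
  "concentration_constants nrm \<Xi> P m b b1 b2 \<longleftrightarrow> b1 > 0 \<and> b2 > 0 \<and>
     (\<forall>\<beta>. 0 < \<beta> \<and> \<beta> < 1 \<longrightarrow> 0 \<le> ln (b1 / \<beta>) \<and>
       (\<forall>N\<ge>1. outer_measure_of (sample_measure N P)
                {w \<in> space (sample_measure N P).
                   ennreal (conc_radius m b b1 b2 N \<beta>) \<le> wasserstein nrm \<Xi> P (empirical {1..N} w)}
              \<le> ennreal \<beta>))"

end

theory Submission
  imports Defs
begin

text \<open>With probability at least \<open>1 - \<beta>\<close> there is a coupling \<open>\<pi>\<close> of \<open>P\<close> with the empirical
  distribution of all data whose cost is below \<open>theta_min\<close>. Splitting \<open>\<pi>\<close> according to the cluster
  of its second coordinate writes \<open>P\<close> as the mixture, with the cluster frequencies as weights, of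
  measures \<open>Q\<^sub>k\<close> that are coupled to the empirical distributions of the clusters. The \<open>k\<close>-th
  coupling is \<open>\<pi>\<close> with a density at most \<open>N / n\<^sub>k\<close>, where \<open>n\<^sub>k\<close> is the size of the \<open>k\<close>-th cluster,
  so \<open>Q\<^sub>k\<close> has cost at most \<open>N / n\<^sub>k * theta_min \<le> \<theta>\<^sub>k\<close>. Hence \<open>P\<close> lies in the ambiguity set,
  and the robust objective dominates the true one.\<close>

section \<open>Integrals against a bounded density\<close>

lemma nn_integral_density_le:
  assumes h [measurable]: "h \<in> borel_measurable M"
    and le: "AE x in M. h x \<le> C"
  shows "(\<integral>\<^sup>+x. u x \<partial>density M h) \<le> C * (\<integral>\<^sup>+x. u x \<partial>M)"
  unfolding nn_integral_def[of "density M h"]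
proof (rule SUP_least)
  fix s assume "s \<in> {s. simple_function (density M h) s \<and> s \<le> u}"
  \<comment> \<open>\<open>density\<close> changes neither the space nor the sigma-algebra, so both
    measures have the same simple functions.\<close>
  hence s: "simple_function M s" and su: "s \<le> u"
    by (auto simp: simple_function_def)
  note [measurable] = borel_measurable_simple_function[OF s]
  have "integral\<^sup>S (density M h) s = (\<integral>\<^sup>+x. s x \<partial>density M h)"
    using s by (intro nn_integral_eq_simple_integral[symmetric]) (simp add: simple_function_def)
  also have "\<dots> = (\<integral>\<^sup>+x. h x * s x \<partial>M)"
    by (rule nn_integral_density) measurable
  also have "\<dots> \<le> (\<integral>\<^sup>+x. C * s x \<partial>M)"
    by (rule nn_integral_mono_AE, use le in eventually_elim) (rule mult_right_mono, simp_all)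
  also have "\<dots> = C * (\<integral>\<^sup>+x. s x \<partial>M)"
    by (rule nn_integral_cmult) measurable
  also have "\<dots> \<le> C * (\<integral>\<^sup>+x. u x \<partial>M)"
    using su by (intro mult_left_mono nn_integral_mono) (auto simp: le_fun_def)
  finally show "integral\<^sup>S (density M h) s \<le> C * (\<integral>\<^sup>+x. u x \<partial>M)" .
qed

section \<open>Empirical distributions\<close>

text \<open>Pushing forward the uniform distribution on the indices keeps multiplicities, and every
  \<open>w\<close> is measurable on a discrete space. Integrals, total mass and almost-everywhere
  statements for \<open>empirical\<close> are thereby reduced to the finite index set.\<close>

lemma empirical_eq_distr:
  assumes "finite I" "I \<noteq> {}"
  shows "empirical I w = distr (uniform_count_measure I) borel w"
proof (rule measure_eqI)
  show "sets (empirical I w) = sets (distr (uniform_count_measure I) borel w)"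
    by (simp add: empirical_def)
next
  fix A assume "A \<in> sets (empirical I w)"
  hence A: "A \<in> sets borel" by (simp add: empirical_def)
  have "emeasure (empirical I w) A = (\<Sum>i\<in>I. ennreal (1 / real (card I)) * indicator A (w i))"
    unfolding empirical_def using A by (subst emeasure_mixture) auto
  also have "\<dots> = (\<Sum>i\<in>I. ennreal (1 / real (card I) * indicator A (w i)))"
    by (intro sum.cong refl) (auto simp: indicator_def)
  also have "\<dots> = ennreal (\<Sum>i\<in>I. 1 / real (card I) * indicator A (w i))"
    by (intro sum_ennreal) auto
  also have "(\<Sum>i\<in>I. 1 / real (card I) * indicator A (w i)) = real (card (w -` A \<inter> I)) / real (card I)"
    using assms by (simp add: sum_distrib_left[symmetric] indicator_def sum.If_cases Int_commute
        vimage_def Collect_conj_eq sum_divide_distrib[symmetric])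
  finally show "emeasure (empirical I w) A = emeasure (distr (uniform_count_measure I) borel w) A"
    using A assms by (subst emeasure_distr)
      (auto simp: emeasure_uniform_count_measure space_uniform_count_measure measurable_def
        sets_uniform_count_measure ennreal_of_nat_eq_real_of_nat divide_ennreal)
qed

lemma sets_empirical [simp]: "sets (empirical I w) = sets borel"
  by (simp add: empirical_def)

lemma nn_integral_empirical:
  assumes "finite I" "I \<noteq> {}" and F: "F \<in> borel_measurable borel"
  shows "(\<integral>\<^sup>+v. F v \<partial>empirical I w) = (\<Sum>i\<in>I. F (w i)) / of_nat (card I)"
proof -
  have w: "w \<in> measurable (uniform_count_measure I) borel"
    by (auto simp: measurable_def space_uniform_count_measure sets_uniform_count_measure)
  have c: "ennreal (1 / real (card I)) = inverse (of_nat (card I))"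
    using assms by (simp add: ennreal_of_nat_eq_real_of_nat inverse_ennreal card_gt_0_iff inverse_eq_divide)
  have "(\<integral>\<^sup>+v. F v \<partial>empirical I w) = (\<Sum>i\<in>I. ennreal (1 / real (card I)) * F (w i))"
    unfolding empirical_eq_distr[OF assms(1,2)]
    using assms by (subst nn_integral_distr[OF w])
      (simp_all add: uniform_count_measure_def nn_integral_point_measure_finite)
  thus ?thesis
    unfolding c sum_distrib_left[symmetric] divide_ennreal_def by (simp only: mult.commute)
qed

lemma prob_space_empirical:
  assumes "finite I" "I \<noteq> {}"
  shows "prob_space (empirical I w)"
proof -
  interpret prob_space "uniform_count_measure I"
    using assms by (rule prob_space_uniform_count_measure)
  show ?thesis unfolding empirical_eq_distr[OF assms]
    by (rule prob_space_distr)
       (auto simp: measurable_def space_uniform_count_measure sets_uniform_count_measure)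
qed

section \<open>Occurrence counts and cluster densities\<close>

text \<open>Different clusters may contain the same data value; a value is then shared between them in
  proportion to its multiplicities, which leads to the ratio of counts in \<open>cluster_density\<close>.\<close>

definition occ :: "(nat \<Rightarrow> 'a) \<Rightarrow> nat set \<Rightarrow> 'a \<Rightarrow> real" where
  "occ w I v = (\<Sum>i\<in>I. indicator {w i} v)"

lemma occ_nonneg: "0 \<le> occ w I v"
  by (simp add: occ_def sum_nonneg)

lemma occ_mono: "finite I \<Longrightarrow> J \<subseteq> I \<Longrightarrow> occ w J v \<le> occ w I v"
  unfolding occ_def by (rule sum_mono2) auto

lemma occ_pos: "finite I \<Longrightarrow> i \<in> I \<Longrightarrow> 0 < occ w I (w i)"
  unfolding occ_def by (rule sum_pos2[of _ i]) auto

lemma occ_UNION: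
  assumes "finite S" "\<And>k. k \<in> S \<Longrightarrow> finite (J k)" "disjoint_family_on J S"
  shows "occ w (\<Union>k\<in>S. J k) v = (\<Sum>k\<in>S. occ w (J k) v)"
  unfolding occ_def using assms by (intro sum.UNION_disjoint) (auto simp: disjoint_family_on_def)

text \<open>Singletons are closed in a T1 space, hence Borel.\<close>

lemma measurable_occ [measurable]:
  fixes w :: "nat \<Rightarrow> 'a::t1_space"
  shows "occ w I \<in> borel_measurable borel"
  unfolding occ_def by measurable

text \<open>Expand \<open>occ w J\<close> and swap the sums. For fixed \<open>j\<close>, only the
  indices \<open>i\<close> with \<open>w i = w j\<close> contribute, all equally, and their number
  is \<open>occ w I (w j)\<close>, which cancels the denominator.\<close>

lemma sum_occ_ratio:
  assumes "finite I" "J \<subseteq> I"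
  shows "(\<Sum>i\<in>I. occ w J (w i) / occ w I (w i) * F (w i)) = (\<Sum>j\<in>J. F (w j))"
proof -
  have "(\<Sum>i\<in>I. occ w J (w i) / occ w I (w i) * F (w i)) =
      (\<Sum>i\<in>I. \<Sum>j\<in>J. indicator {w j} (w i) * (F (w i) / occ w I (w i)))"
    by (simp add: occ_def[of w J] sum_divide_distrib sum_distrib_right)
  also have "\<dots> = (\<Sum>j\<in>J. \<Sum>i\<in>I. indicator {w j} (w i) * (F (w i) / occ w I (w i)))"
    by (rule sum.swap)
  also have "\<dots> = (\<Sum>j\<in>J. \<Sum>i\<in>I. indicator {w i} (w j) * (F (w j) / occ w I (w j)))"
    by (intro sum.cong refl) (auto simp: indicator_def)
  also have "\<dots> = (\<Sum>j\<in>J. F (w j))"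
  proof (rule sum.cong[OF refl])
    fix j assume "j \<in> J"
    with assms have "occ w I (w j) \<noteq> 0" using occ_pos[of I j w] by auto
    thus "(\<Sum>i\<in>I. indicator {w i} (w j) * (F (w j) / occ w I (w j))) = F (w j)"
      by (simp only: sum_distrib_right[symmetric] occ_def[symmetric]) simp
  qed
  finally show ?thesis .
qed

text \<open>For finite \<open>I\<close> and nonempty \<open>J \<subseteq> I\<close> this is the
  Radon-Nikodym density of the empirical distribution of \<open>J\<close> with respect to that of
  \<open>I\<close>. At values outside the data the ratio is 0 / 0 = 0, so the bound on the density
  holds everywhere.\<close>

definition cluster_density :: "(nat \<Rightarrow> 'a) \<Rightarrow> nat set \<Rightarrow> nat set \<Rightarrow> 'a \<Rightarrow> ennreal" where
  "cluster_density w I J v = ennreal (real (card I) / real (card J) * (occ w J v / occ w I v))"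

lemma measurable_cluster_density [measurable]:
  fixes w :: "nat \<Rightarrow> 'a::t1_space"
  shows "cluster_density w I J \<in> borel_measurable borel"
  unfolding cluster_density_def by measurable

lemma cluster_density_le:
  assumes "finite I" "J \<subseteq> I"
  shows "cluster_density w I J v \<le> ennreal (real (card I) / real (card J))"
proof -
  have "occ w J v / occ w I v \<le> 1"
    using occ_mono[OF assms, of w v] occ_nonneg[of w I v] by (auto simp: divide_le_eq_1)
  thus ?thesis unfolding cluster_density_def
    by (intro ennreal_leI mult_left_le) auto
qed

text \<open>\<open>sum_occ_ratio\<close> turns the weighted sum over \<open>I\<close> into a sum
  over \<open>J\<close>, and the factor \<open>card I / card J\<close> exchanges the
  normalizations.\<close>

lemma density_empirical:
  fixes w :: "nat \<Rightarrow> 'a::t1_space"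
  assumes I: "finite I" and J: "J \<subseteq> I" "J \<noteq> {}"
  shows "density (empirical I w) (cluster_density w I J) = empirical J w"
proof (rule measure_eqI)
  fix A assume "A \<in> sets (density (empirical I w) (cluster_density w I J))"
  hence A [measurable]: "A \<in> sets borel" by simp
  have ne: "I \<noteq> {}" "finite J" using I J finite_subset by auto
  have cI: "real (card I) > 0" "real (card J) > 0" using I J ne by (auto simp: card_gt_0_iff)
  have "emeasure (density (empirical I w) (cluster_density w I J)) A
      = (\<integral>\<^sup>+v. cluster_density w I J v * indicator A v \<partial>empirical I w)"
    by (rule emeasure_density) (simp_all add: measurable_cong_sets[OF sets_empirical refl])
  also have "\<dots> = (\<Sum>i\<in>I. cluster_density w I J (w i) * indicator A (w i)) / of_nat (card I)"
    using I ne by (intro nn_integral_empirical) auto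
  also have "(\<Sum>i\<in>I. cluster_density w I J (w i) * indicator A (w i)) =
      (\<Sum>i\<in>I. ennreal (real (card I) / real (card J) * (occ w J (w i) / occ w I (w i) * indicator A (w i))))"
    by (intro sum.cong refl) (auto simp: cluster_density_def indicator_def)
  also have "\<dots> = ennreal (\<Sum>i\<in>I. real (card I) / real (card J) * (occ w J (w i) / occ w I (w i) * indicator A (w i)))"
    by (intro sum_ennreal mult_nonneg_nonneg divide_nonneg_nonneg occ_nonneg) auto
  also have "(\<Sum>i\<in>I. real (card I) / real (card J) * (occ w J (w i) / occ w I (w i) * indicator A (w i)))
      = real (card I) / real (card J) * (\<Sum>j\<in>J. indicator A (w j))"
    by (simp only: sum_distrib_left[symmetric] sum_occ_ratio[OF I J(1)])
  also have "ennreal \<dots> / of_nat (card I) = ennreal ((\<Sum>j\<in>J. indicator A (w j)) / real (card J))"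
    using cI by (simp add: ennreal_of_nat_eq_real_of_nat divide_ennreal sum_nonneg)
  also have "\<dots> = (\<Sum>j\<in>J. indicator A (w j)) / of_nat (card J)"
    using cI by (simp add: ennreal_of_nat_eq_real_of_nat divide_ennreal[symmetric] sum_nonneg
        sum_ennreal[symmetric] ennreal_indicator)
  also have "\<dots> = (\<integral>\<^sup>+v. indicator A v \<partial>empirical J w)"
    using J ne by (intro nn_integral_empirical[symmetric]) auto
  finally show "emeasure (density (empirical I w) (cluster_density w I J)) A = emeasure (empirical J w) A"
    by simp
qed simp

text \<open>Outside the data all cluster densities are 0 and cannot add up to the right total; such
  values have to be excluded as a null set.\<close>

lemma AE_empirical_occ_pos:
  fixes w :: "nat \<Rightarrow> 'a::t1_space"
  assumes "finite I" "I \<noteq> {}"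
  shows "AE v in empirical I w. 0 < occ w I v"
proof -
  have "AE i in uniform_count_measure I. 0 < occ w I (w i)"
    using assms by (intro AE_I2) (auto simp: space_uniform_count_measure intro: occ_pos)
  moreover have "w \<in> measurable (uniform_count_measure I) borel"
    by (auto simp: measurable_def space_uniform_count_measure sets_uniform_count_measure)
  ultimately show ?thesis
    unfolding empirical_eq_distr[OF assms] by (subst AE_distr_iff) auto
qed

section \<open>Splitting a coupling along the clusters\<close>

text \<open>The density of the \<open>k\<close>-th piece depends on the second coordinate only, so
  it turns the second marginal into \<open>empirical (J k) w\<close>. Weighted by the cluster
  frequencies, the densities add up to 1 almost everywhere, so the first marginals mix back to
  \<open>P\<close>.\<close>

lemma coupling_decomposition:
  fixes w :: "nat \<Rightarrow> 'a::{t1_space, minus}"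
  assumes S: "finite S" and I: "finite I" "I \<noteq> {}"
    and J: "\<And>k. k \<in> S \<Longrightarrow> J k \<noteq> {}" "disjoint_family_on J S" "(\<Union>k\<in>S. J k) = I"
    and P: "P \<in> prob_measures_on \<Xi>"
    and \<pi>: "\<pi> \<in> couplings \<Xi> P (empirical I w)"
  obtains Q where "\<And>k. k \<in> S \<Longrightarrow> Q k \<in> prob_measures_on \<Xi>"
    and "\<And>k. k \<in> S \<Longrightarrow> wasserstein nrm \<Xi> (Q k) (empirical (J k) w) \<le>
           ennreal (real (card I) / real (card (J k))) * (\<integral>\<^sup>+z. ennreal (nrm (fst z - snd z)) \<partial>\<pi>)"
    and "mixture S (\<lambda>k. real (card (J k)) / real (card I)) Q = P"
proof -
  have sets_pi [measurable_cong]: "sets \<pi> = sets (borel \<Otimes>\<^sub>M borel)"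
    and supp: "AE z in \<pi>. z \<in> \<Xi> \<times> \<Xi>"
    and fst_pi: "distr \<pi> borel fst = P" and snd_pi: "distr \<pi> borel snd = empirical I w"
    using \<pi> by (auto simp: couplings_def)
  have setsP: "sets P = sets borel" and AEP: "AE v in P. v \<in> \<Xi>"
    using P by (auto simp: prob_measures_on_def)
  have Jsub: "J k \<subseteq> I" if "k \<in> S" for k using J(3) that by auto
  have Jfin: "finite (J k)" if "k \<in> S" for k using Jsub[OF that] I finite_subset by auto
  have cJ: "real (card (J k)) > 0" if "k \<in> S" for k
    using J(1) Jfin that by (auto simp: card_gt_0_iff)
  have cI: "real (card I) > 0" using I by (auto simp: card_gt_0_iff)
  define h where "h k z = cluster_density w I (J k) (snd z)" for k and z :: "'a \<times> 'a"
  have h [measurable]: "h k \<in> borel_measurable (borel \<Otimes>\<^sub>M borel)" for k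
    unfolding h_def by measurable
  have h' [measurable]: "h k \<in> borel_measurable \<pi>" for k by measurable
  define \<rho> where "\<rho> k = density \<pi> (h k)" for k
  define Q where "Q k = distr (\<rho> k) borel fst" for k
  have sets_rho [measurable_cong]: "sets (\<rho> k) = sets (borel \<Otimes>\<^sub>M borel)" for k
    by (simp add: \<rho>_def sets_pi)
  have eQ: "emeasure (Q k) A = (\<integral>\<^sup>+z. h k z * indicator A (fst z) \<partial>\<pi>)"
    if A [measurable]: "A \<in> sets borel" for k A
  proof -
    have "emeasure (Q k) A = (\<integral>\<^sup>+v. indicator A v \<partial>Q k)"
      by (simp add: Q_def)
    also have "\<dots> = (\<integral>\<^sup>+z. indicator A (fst z) \<partial>\<rho> k)"
      unfolding Q_def by (rule nn_integral_distr) measurable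
    also have "\<dots> = (\<integral>\<^sup>+z. h k z * indicator A (fst z) \<partial>\<pi>)"
      unfolding \<rho>_def by (rule nn_integral_density) measurable
    finally show ?thesis .
  qed
  have eP: "emeasure P A = (\<integral>\<^sup>+z. indicator A (fst z) \<partial>\<pi>)"
    if A [measurable]: "A \<in> sets borel" for A
  proof -
    have "emeasure P A = (\<integral>\<^sup>+v. indicator A v \<partial>distr \<pi> borel fst)"
      by (simp add: fst_pi setsP)
    thus ?thesis by (subst (asm) nn_integral_distr) measurable
  qed
  have snd_rho: "distr (\<rho> k) borel snd = empirical (J k) w" if k: "k \<in> S" for k
  proof (rule measure_eqI)
    fix A assume "A \<in> sets (distr (\<rho> k) borel snd)"
    hence A [measurable]: "A \<in> sets borel" by simp
    have "emeasure (distr (\<rho> k) borel snd) A = (\<integral>\<^sup>+v. indicator A v \<partial>distr (\<rho> k) borel snd)"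
      by simp
    also have "\<dots> = (\<integral>\<^sup>+z. indicator A (snd z) \<partial>\<rho> k)"
      by (rule nn_integral_distr) measurable
    also have "\<dots> = (\<integral>\<^sup>+z. cluster_density w I (J k) (snd z) * indicator A (snd z) \<partial>\<pi>)"
      unfolding \<rho>_def h_def[symmetric] by (rule nn_integral_density) measurable
    also have "\<dots> = (\<integral>\<^sup>+v. cluster_density w I (J k) v * indicator A v \<partial>distr \<pi> borel snd)"
      by (rule nn_integral_distr[symmetric]) measurable
    also have "\<dots> = emeasure (density (empirical I w) (cluster_density w I (J k))) A"
      unfolding snd_pi
      by (rule emeasure_density[symmetric]) (simp_all add: measurable_cong_sets[OF sets_empirical refl])
    also have "\<dots> = emeasure (empirical (J k) w) A"
      using density_empirical[OF I(1) Jsub[OF k] J(1)[OF k], of w] by simp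
    finally show "emeasure (distr (\<rho> k) borel snd) A = emeasure (empirical (J k) w) A" .
  qed simp
  have probQ: "Q k \<in> prob_measures_on \<Xi>" if k: "k \<in> S" for k
  proof -
    \<comment> \<open>The total mass of \<open>\<rho> k\<close> is read off from its second
      marginal, already known to be a probability measure.\<close>
    have "prob_space (distr (\<rho> k) borel snd)"
      unfolding snd_rho[OF k] using J(1) Jfin k by (intro prob_space_empirical) auto
    hence "prob_space (\<rho> k)"
      by (rule prob_space_distrD[rotated]) measurable
    hence "prob_space (Q k)"
      unfolding Q_def by (rule prob_space.prob_space_distr) measurable
    moreover have "AE v in Q k. v \<in> \<Xi>"
    proof -
      \<comment> \<open>\<open>\<Xi>\<close> may fail to be Borel, so its complement is covered by a
        Borel \<open>P\<close>-null set. That set is null for \<open>Q k\<close> too, because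
        \<open>\<rho> k\<close> is absolutely continuous with respect to
        \<open>\<pi>\<close>.\<close>
      obtain Z where Z: "Z \<in> null_sets P" and sub: "{v \<in> space P. v \<notin> \<Xi>} \<subseteq> Z"
        using AEP by (auto elim!: AE_E intro: that)
      have [measurable]: "Z \<in> sets borel" using Z setsP by auto
      have "AE z in \<pi>. indicator Z (fst z) = (0::ennreal)"
        using eP[of Z] Z by (subst nn_integral_0_iff_AE[symmetric]) auto
      hence "emeasure (Q k) Z = 0"
        unfolding eQ[OF \<open>Z \<in> sets borel\<close>]
        by (subst nn_integral_0_iff_AE) auto
      hence "Z \<in> null_sets (Q k)" by (auto simp: Q_def)
      thus ?thesis
        by (rule AE_I') (use sub sets_eq_imp_space_eq[OF setsP] in \<open>auto simp: Q_def\<close>)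
    qed
    moreover have "sets (Q k) = sets borel" by (simp add: Q_def)
    ultimately show ?thesis by (simp add: prob_measures_on_def)
  qed
  moreover have "wasserstein nrm \<Xi> (Q k) (empirical (J k) w) \<le>
      ennreal (real (card I) / real (card (J k))) * (\<integral>\<^sup>+z. ennreal (nrm (fst z - snd z)) \<partial>\<pi>)"
    if k: "k \<in> S" for k
  proof -
    have "AE z in \<rho> k. z \<in> \<Xi> \<times> \<Xi>"
      unfolding \<rho>_def AE_density[OF h'] using supp by eventually_elim simp
    hence "\<rho> k \<in> couplings \<Xi> (Q k) (empirical (J k) w)"
      using snd_rho[OF k] sets_rho[of k] by (simp add: couplings_def Q_def)
    hence "wasserstein nrm \<Xi> (Q k) (empirical (J k) w) \<le> (\<integral>\<^sup>+z. ennreal (nrm (fst z - snd z)) \<partial>\<rho> k)"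
      unfolding wasserstein_def by (rule INF_lower)
    also have "\<dots> \<le> ennreal (real (card I) / real (card (J k))) * (\<integral>\<^sup>+z. ennreal (nrm (fst z - snd z)) \<partial>\<pi>)"
      unfolding \<rho>_def
      by (rule nn_integral_density_le) (auto simp: h_def intro!: AE_I2 cluster_density_le I Jsub k)
    finally show ?thesis .
  qed
  moreover have "mixture S (\<lambda>k. real (card (J k)) / real (card I)) Q = P"
  proof (rule measure_eqI)
    fix A assume "A \<in> sets (mixture S (\<lambda>k. real (card (J k)) / real (card I)) Q)"
    hence A [measurable]: "A \<in> sets borel" by simp
    \<comment> \<open>The clusters partition the indices, so the counts in the clusters add up to
      \<open>occ w I v\<close>.\<close>
    have one: "(\<Sum>k\<in>S. ennreal (real (card (J k)) / real (card I)) * cluster_density w I (J k) v) = 1"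
      if "0 < occ w I v" for v
    proof -
      have "(\<Sum>k\<in>S. ennreal (real (card (J k)) / real (card I)) * cluster_density w I (J k) v)
          = (\<Sum>k\<in>S. ennreal (occ w (J k) v / occ w I v))"
      proof (rule sum.cong[OF refl])
        fix k assume "k \<in> S"
        thus "ennreal (real (card (J k)) / real (card I)) * cluster_density w I (J k) v
            = ennreal (occ w (J k) v / occ w I v)"
          unfolding cluster_density_def using cJ[of k] cI by (subst ennreal_mult'[symmetric]) auto
      qed
      also have "\<dots> = ennreal (\<Sum>k\<in>S. occ w (J k) v / occ w I v)"
        by (intro sum_ennreal divide_nonneg_nonneg occ_nonneg)
      also have "(\<Sum>k\<in>S. occ w (J k) v / occ w I v) = 1"
        using occ_UNION[OF S Jfin J(2), of w v] that
        by (simp add: J(3) sum_divide_distrib[symmetric])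
      finally show ?thesis by simp
    qed
    \<comment> \<open>The second coordinate under \<open>\<pi>\<close> is almost surely a data
      value, so \<open>one\<close> applies almost everywhere.\<close>
    have "AE v in distr \<pi> borel snd. 0 < occ w I v"
      unfolding snd_pi by (rule AE_empirical_occ_pos[OF I])
    hence AEocc: "AE z in \<pi>. 0 < occ w I (snd z)"
      by (subst (asm) AE_distr_iff) measurable
    have "emeasure (mixture S (\<lambda>k. real (card (J k)) / real (card I)) Q) A
        = (\<Sum>k\<in>S. ennreal (real (card (J k)) / real (card I)) * (\<integral>\<^sup>+z. h k z * indicator A (fst z) \<partial>\<pi>))"
      by (subst emeasure_mixture) (auto simp: Q_def eQ[unfolded Q_def] A)
    also have "\<dots> = (\<Sum>k\<in>S. \<integral>\<^sup>+z. ennreal (real (card (J k)) / real (card I)) * (h k z * indicator A (fst z)) \<partial>\<pi>)"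
      by (intro sum.cong refl nn_integral_cmult[symmetric]) measurable
    also have "\<dots> = (\<integral>\<^sup>+z. (\<Sum>k\<in>S. ennreal (real (card (J k)) / real (card I)) * (h k z * indicator A (fst z))) \<partial>\<pi>)"
      by (intro nn_integral_sum[symmetric]) measurable
    also have "\<dots> = (\<integral>\<^sup>+z. indicator A (fst z) \<partial>\<pi>)"
    proof (rule nn_integral_cong_AE, use AEocc in eventually_elim)
      fix z :: "'a \<times> 'a" assume "0 < occ w I (snd z)"
      thus "(\<Sum>k\<in>S. ennreal (real (card (J k)) / real (card I)) * (h k z * indicator A (fst z))) = indicator A (fst z)"
        unfolding h_def mult.assoc[symmetric] sum_distrib_right[symmetric] by (simp add: one)
    qed
    also have "\<dots> = emeasure P A" by (simp add: eP)
    finally show "emeasure (mixture S (\<lambda>k. real (card (J k)) / real (card I)) Q) A = emeasure P A" .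
  qed (simp add: setsP)
  ultimately show thesis by (rule that)
qed

section \<open>Membership of the true distribution in the ambiguity set\<close>

lemma mem_ambiguity_set:
  fixes w :: "nat \<Rightarrow> 'a::{t1_space, minus}"
  assumes P: "P \<in> prob_measures_on \<Xi>" and N: "N \<ge> 1"
    and l: "l ` {1..N} = {1..K}"
    and close: "wasserstein nrm \<Xi> P (empirical {1..N} w) < ennreal (theta_min N K l \<theta>)"
  shows "P \<in> ambiguity_set nrm \<Xi> N K l \<theta> w"
proof -
  define J where "J = cluster N l"
  have ne: "J k \<noteq> {}" if "k \<in> {1..K}" for k
  proof -
    from that have "k \<in> l ` {1..N}" using l by simp
    thus ?thesis by (auto simp: J_def cluster_def)
  qed
  have disj: "disjoint_family_on J {1..K}"
    by (auto simp: J_def cluster_def disjoint_family_on_def)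
  have un: "(\<Union>k\<in>{1..K}. J k) = {1..N}"
    unfolding l[symmetric] by (auto simp: J_def cluster_def)
  \<comment> \<open>The infimum over couplings might not be attained; the strict inequality still
    yields a coupling with cost below \<open>theta_min\<close>.\<close>
  obtain \<pi> where \<pi>: "\<pi> \<in> couplings \<Xi> P (empirical {1..N} w)"
    and cost: "(\<integral>\<^sup>+z. ennreal (nrm (fst z - snd z)) \<partial>\<pi>) < ennreal (theta_min N K l \<theta>)"
    using close unfolding wasserstein_def INF_less_iff by blast
  obtain Q where Q: "\<And>k. k \<in> {1..K} \<Longrightarrow> Q k \<in> prob_measures_on \<Xi>"
    and WQ: "\<And>k. k \<in> {1..K} \<Longrightarrow> wasserstein nrm \<Xi> (Q k) (empirical (J k) w) \<le>
        ennreal (real (card {1..N}) / real (card (J k))) * (\<integral>\<^sup>+z. ennreal (nrm (fst z - snd z)) \<partial>\<pi>)"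
    and mix: "mixture {1..K} (\<lambda>k. real (card (J k)) / real (card {1..N})) Q = P"
    by (rule coupling_decomposition[OF _ _ _ ne disj un P \<pi>, where nrm = nrm]) (use N in auto)
  have "Q k \<in> wasserstein_ball nrm \<Xi> (\<theta> k) (empirical (J k) w)" if k: "k \<in> {1..K}" for k
  proof -
    have cJ: "real (card (J k)) > 0"
      using ne[OF k] by (auto simp: J_def cluster_def card_gt_0_iff)
    \<comment> \<open>The weights \<open>n / N\<close> inside \<open>theta_min\<close>, with
      \<open>n\<close> the cluster size, compensate exactly the factor \<open>N / n\<close> by which
      the split may increase the cost.\<close>
    have "theta_min N K l \<theta> \<le> real (card (J k)) / real N * \<theta> k"
      unfolding theta_min_def J_def using k by (intro Min_le) auto
    hence "real N / real (card (J k)) * theta_min N K l \<theta> \<le> \<theta> k"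
      using cJ N by (simp add: field_simps)
    moreover have "wasserstein nrm \<Xi> (Q k) (empirical (J k) w) \<le>
        ennreal (real N / real (card (J k))) * ennreal (theta_min N K l \<theta>)"
      using WQ[OF k] mult_left_mono[OF less_imp_le[OF cost] zero_le] by (simp add: order_trans)
    ultimately have "wasserstein nrm \<Xi> (Q k) (empirical (J k) w) \<le> ennreal (\<theta> k)"
      by (auto simp: ennreal_mult'[symmetric] intro: order_trans ennreal_leI)
    thus ?thesis using Q[OF k] by (simp add: wasserstein_ball_def)
  qed
  thus ?thesis using mix unfolding ambiguity_set_def J_def by auto
qed

section \<open>Robust bound, inner probability and support of the sample\<close>

text \<open>\<open>expect P (g x)\<close> is one of the terms of the supremum, addition on
  \<open>ereal\<close> is monotone also at infinite values, and the minimizer \<open>x\<close>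
  attains the infimum.\<close>

lemma robust_bound:
  assumes "is_arg_min (robust_objective f g B) (\<lambda>x. x \<in> X) x" "P \<in> B"
  shows "f x + expect P (g x) \<le> robust_value X f g B"
proof -
  have "f x + expect P (g x) \<le> robust_objective f g B x"
    unfolding robust_objective_def using assms(2) by (intro add_left_mono SUP_upper)
  also have "\<dots> \<le> robust_value X f g B"
    unfolding robust_value_def using assms(1) by (intro INF_greatest) (auto simp: is_arg_min_def not_less)
  finally show ?thesis .
qed

text \<open>Neither \<open>A\<close> nor \<open>G\<close> has to be measurable. A measurable cover
  \<open>E\<close> of \<open>A\<close> has the same outer measure, and after removal of
  \<open>E\<close> and of a null set \<open>Z\<close> a measurable subset of \<open>G\<close>
  remains.\<close>

lemma inner_measure_of_ge:
  assumes "prob_space M" and \<beta>: "0 \<le> \<beta>" and outer: "outer_measure_of M A \<le> ennreal \<beta>"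
    and A: "A \<subseteq> space M" and AE: "AE w in M. w \<notin> A \<longrightarrow> w \<in> G"
  shows "ennreal (1 - \<beta>) \<le> inner_measure_of M G"
proof -
  interpret prob_space M by fact
  obtain E where E: "E \<in> sets M" "A \<subseteq> E" "outer_measure_of M A = emeasure M E"
    using outer_measure_of_attain[OF A] by blast
  obtain Z where Z: "Z \<in> null_sets M" and sub: "{w \<in> space M. \<not> (w \<notin> A \<longrightarrow> w \<in> G)} \<subseteq> Z"
    using AE by (auto elim!: AE_E intro: that)
  have ZM: "Z \<in> sets M" using Z by auto
  have mem: "space M - (E \<union> Z) \<in> {B \<in> sets M. B \<subseteq> G}"
    using E ZM sub by auto
  have "emeasure M (E \<union> Z) \<le> ennreal \<beta>"
    using emeasure_Un_null_set[OF E(1) Z] outer E(3) by simp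
  hence "1 - ennreal \<beta> \<le> 1 - emeasure M (E \<union> Z)"
    by (rule ennreal_minus_mono[OF order_refl])
  hence "ennreal (1 - \<beta>) \<le> 1 - emeasure M (E \<union> Z)"
    using ennreal_minus[OF \<beta>, of 1] by simp
  also have "\<dots> = emeasure M (space M - (E \<union> Z))"
    using E ZM by (simp add: emeasure_compl emeasure_space_1)
  also have "\<dots> \<le> inner_measure_of M G"
    unfolding inner_measure_of_def by (rule SUP_upper[OF mem])
  finally show ?thesis .
qed

text \<open>Each of the finitely many coordinates has law \<open>P\<close>. In the theorem the
  clustering rule and the minimizers are constrained only on such samples.\<close>

lemma AE_sample_in:
  assumes P: "P \<in> prob_measures_on \<Xi>"
  shows "AE w in sample_measure N P. w \<in> {1..N} \<rightarrow>\<^sub>E \<Xi>"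
proof -
  have "prob_space P" and AE: "AE v in P. v \<in> \<Xi>"
    using P by (auto simp: prob_measures_on_def)
  hence "AE w in sample_measure N P. w i \<in> \<Xi>" if "i \<in> {1..N}" for i
    using AE_PiM_component[of "{1..N}" "\<lambda>_. P" i] that by auto
  hence "AE w in sample_measure N P. \<forall>i\<in>{1..N}. w i \<in> \<Xi>"
    by (intro AE_finite_allI) auto
  thus ?thesis
    by (rule AE_mp) (auto intro!: AE_I2 simp: space_PiM PiE_iff)
qed

section \<open>The finite sample guarantee\<close>

theorem theorem2:
  fixes nrm :: "real ^ 'm \<Rightarrow> real"
    and \<Xi> :: "(real ^ 'm) set"
    and P :: "(real ^ 'm) measure"
    and X :: "(real ^ 'n) set"
    and f :: "real ^ 'n \<Rightarrow> ereal"
    and g :: "real ^ 'n \<Rightarrow> real ^ 'm \<Rightarrow> ereal"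
    and N :: nat
    and K :: "(nat \<Rightarrow> real ^ 'm) \<Rightarrow> nat"
    and lab :: "(nat \<Rightarrow> real ^ 'm) \<Rightarrow> nat \<Rightarrow> nat"
    and \<theta> :: "(nat \<Rightarrow> real ^ 'm) \<Rightarrow> nat \<Rightarrow> real"
    and B :: "(nat \<Rightarrow> real ^ 'm) \<Rightarrow> (real ^ 'm) measure set"
    and xhat :: "(nat \<Rightarrow> real ^ 'm) \<Rightarrow> real ^ 'n"
    and \<beta> b b1 b2 :: real
  defines "B \<equiv> (\<lambda>w. ambiguity_set nrm \<Xi> N (K w) (lab w) (\<theta> w) w)"
  assumes norm: "is_norm nrm"
    and P: "P \<in> prob_measures_on \<Xi>"
    and N: "N \<ge> 1"
    and clusters: "clustering_rule \<Xi> N K lab"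
    and radii: "\<And>w k. w \<in> {1..N} \<rightarrow>\<^sub>E \<Xi> \<Longrightarrow> k \<in> {1..K w} \<Longrightarrow> \<theta> w k > 0"
    and xhat: "\<And>w. w \<in> {1..N} \<rightarrow>\<^sub>E \<Xi> \<Longrightarrow> is_arg_min (robust_objective f g (B w)) (\<lambda>x. x \<in> X) (xhat w)"
    and \<beta>: "0 < \<beta>" "\<beta> < 1"
    and light: "light_tailed nrm P b"
    and conc: "concentration_constants nrm \<Xi> P CARD('m) b b1 b2"
    and theta: "AE w in sample_measure N P.
                  theta_min N (K w) (lab w) (\<theta> w) \<ge> conc_radius CARD('m) b b1 b2 N \<beta>"
  shows "inner_measure_of (sample_measure N P)
           {w \<in> space (sample_measure N P).
              f (xhat w) + expect P (g (xhat w)) \<le> robust_value X f g (B w)}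
         \<ge> ennreal (1 - \<beta>)"
proof (rule inner_measure_of_ge)
  let ?M = "sample_measure N P"
  let ?\<epsilon> = "conc_radius CARD('m) b b1 b2 N \<beta>"
  \<comment> \<open>The exceptional event of the concentration inequality, of outer probability at
    most \<open>\<beta>\<close>.\<close>
  let ?A = "{w \<in> space ?M. ennreal ?\<epsilon> \<le> wasserstein nrm \<Xi> P (empirical {1..N} w)}"
  show "prob_space ?M"
    using P by (intro prob_space_PiM) (auto simp: prob_measures_on_def)
  show "0 \<le> \<beta>" using \<beta> by simp
  show "outer_measure_of ?M ?A \<le> ennreal \<beta>"
    using conc \<beta> N unfolding concentration_constants_def by blast
  show "?A \<subseteq> space ?M" by blast
  show "AE w in ?M. w \<notin> ?A \<longrightarrow>
      w \<in> {w \<in> space ?M. f (xhat w) + expect P (g (xhat w)) \<le> robust_value X f g (B w)}"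
    using theta AE_sample_in[OF P, of N] AE_space
  proof eventually_elim
    case (elim w)
    show ?case
    proof
      assume "w \<notin> ?A"
      \<comment> \<open>The exceptional event is defined by a non-strict inequality, so its
        complement gives the strict one that \<open>mem_ambiguity_set\<close> asks for.\<close>
      hence "wasserstein nrm \<Xi> P (empirical {1..N} w) < ennreal ?\<epsilon>"
        using elim(3) by auto
      also have "\<dots> \<le> ennreal (theta_min N (K w) (lab w) (\<theta> w))"
        using elim(1) by (rule ennreal_leI)
      finally have "P \<in> B w"
        using clusters elim(2) unfolding B_def clustering_rule_def
        by (intro mem_ambiguity_set[OF P N]) auto
      with xhat[OF elim(2)] elim(3)
      show "w \<in> {w \<in> space ?M. f (xhat w) + expect P (g (xhat w)) \<le> robust_value X f g (B w)}"
        by (auto intro: robust_bound)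
    qed
  qed
qed

end
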